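(* If $e$ is an inner edge of the root graph of a construction $G$, then there are two constructions $H_W$ and $H_E$ such that $G$ is $\rho$-equivalent to $H_W[e_W-e_E]H_E$ (where, by the notational convention for cuts, $e$ is the new edge introduced by the cut $[e_W-e_E]$).
   Context: **Digraphs.** A digraph is an irreflexive binary relation $D$ on a finite nonempty set, the set of vertices of $D$. The ordered pairs in $D$ are its edges; an edge $(a,b)$ begins in $a$ and ends in $b$. An oriented graph is an antisymmetric digraph. A W-vertex of $D$ is a vertex in which no edge ends; an E-vertex is a vertex in which no edge begins; an inner vertex is one that is neither. A W-edge is an edge beginning in a W-vertex; an E-edge is an edge ending in an E-vertex; an inner edge is an edge beginning in an inner vertex and ending in an inner vertex. A W-edge $(a,b)$ is functional when $(a,c)\in D$ implies $c=b$; an E-edge $(b,a)$ is functional when $(c,a)\in D$ implies $c=b$. Digraphs are disjoint when their vertex sets are disjoint. **Basic K-graphs.** A basic K-graph $B$ is an oriented graph with vertices $a_1,\dots,a_{k_W},b,c_1,\dots,c_{k_E}$ (all distinct, $k_W,k_E\ge 1$) and edges exactly $(a_i,b)$ for $1\le i\le k_W$ and $(b,c_j)$ for $1\le j\le k_E$, together with distinguished W-edges $NW(B),SW(B)$ and distinguished E-edges $NE(B),SE(B)$, such that for each $X\in\{W,E\}$: if $k_X\ge 2$, then $NX(B)\ne SX(B)$. **Cut.** Let $D_W,D_E$ be disjoint oriented graphs, $e_W=(a,b)$ a functional E-edge of $D_W$ and $e_E=(c,d)$ a functional W-edge of $D_E$. With $e=(a,d)$, $D_W[e_W-e_E]D_E$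 is the oriented graph $(D_W-\{e_W\})\cup(D_E-\{e_E\})\cup\{e\}$ on the union of the vertices of $D_W$ and $D_E$ with $b$ and $c$ omitted. The edge $e$ is the new edge introduced by the cut; similarly $f$ for $[f_W-f_E]$. **Constructions.** A construction $G$ is a finite binary tree with an oriented graph and distinguished edges at each node; the graph at the root is the root graph of $G$, and its distinguished edges at the root are denoted $YX(G)$, $Y\in\{N,S\}$, $X\in\{W,E\}$. Constructions are defined inductively: (1) a single-node tree whose node carries a basic K-graph $B$ with its distinguished edges is a construction; (2) if $G_W,G_E$ are constructions with disjoint root graphs $D_W,D_E$, $e_W$ is a functional E-edge of $D_W$ and $e_E$ is a functional W-edge of $D_E$, and for every $Y\in\{N,S\}$ we have $e_W=YE(G_W)$ or $e_E=YW(G_E)$, then $G=G_W[e_W-e_E]G_E$ is a construction: its tree has a new root whose successors are the roots of $G_W$ and $G_E$, its root graph is $D_W[e_W-e_E]D_E$, and for $Y\in\{N,S\}$, $YW(G)=YW(G_W)$ if $e_E=YW(G_E)$ and $YW(G)=YW(G_E)$ otherwise; $YE(G)=YE(G_E)$ if $e_W=YE(G_W)$ and $YE(G)=YE(G_W)$ otherwise. The other nodes keep their data from $G_W$ and $G_E$. **$\rho$-equivalence.** Let $P,Q,R$ be constructions. Define relations between constructions $G_1$ and $G_2$ as follows. - $\rho_1$: $G_1=(P[e_W-e_E]Q)[f_W-f_E]R$ and $G_2=P[e_W-e_E](Q[f_W-f_E]R)$, where $e_W,f_W$ are E-edges of the root graphs of $P,Q$ and $e_E,f_E$ are W-edges of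 the root graphs of $Q,R$ respectively. - $\rho_2$: $G_1=(P[e_W-e_E]Q)[f_W-f_E]R$ and $G_2=(P[f_W-f_E]R)[e_W-e_E]Q$, where $e_W,f_W$ are different E-edges of the root graph of $P$ and $e_E,f_E$ are W-edges of the root graphs of $Q,R$ respectively. - $\rho_3$: $G_1=R[f_W-f_E](Q[e_W-e_E]P)$ and $G_2=Q[e_W-e_E](R[f_W-f_E]P)$, where $e_E,f_E$ are different W-edges of the root graph of $P$ and $e_W,f_W$ are E-edges of the root graphs of $Q,R$ respectively. $\rho$-equivalence is the equivalence relation between constructions that is the reflexive, symmetric and transitive closure of $\rho_1\cup\rho_2\cup\rho_3$, and which is closed moreover under $\rho$-congruence: if $G_1$ is $\rho$-equivalent with $G_2$ and $H_1$ is $\rho$-equivalent with $H_2$, then $G_1[e_W-e_E]H_1$ is $\rho$-equivalent with $G_2[e_W-e_E]H_2$, provided the last two constructions are defined.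
   Formalization: The formal theorem also assumes that the basic K-graphs at distinct leaves of G have disjoint vertex sets (vertices omitted by a cut are not reused elsewhere); without this the claim fails, because regrouping cuts may be undefined. *)

theory Defs
  imports "Graph_Theory.Pair_Digraph"
begin

definition oriented_graph :: "'a pair_pre_digraph \<Rightarrow> bool" where
  "oriented_graph D \<longleftrightarrow> pair_digraph D \<and> pverts D \<noteq> {} \<and> antisym (parcs D)"

definition W_vertex :: "'a pair_pre_digraph \<Rightarrow> 'a \<Rightarrow> bool" where
  "W_vertex D v \<longleftrightarrow> v \<in> pverts D \<and> (\<nexists>u. (u, v) \<in> parcs D)"

definition E_vertex :: "'a pair_pre_digraph \<Rightarrow> 'a \<Rightarrow> bool" where
  "E_vertex D v \<longleftrightarrow> v \<in> pverts D \<and> (\<nexists>u. (v, u) \<in> parcs D)"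

definition inner_vertex :: "'a pair_pre_digraph \<Rightarrow> 'a \<Rightarrow> bool" where
  "inner_vertex D v \<longleftrightarrow> v \<in> pverts D \<and> \<not> W_vertex D v \<and> \<not> E_vertex D v"

definition W_edge :: "'a pair_pre_digraph \<Rightarrow> 'a \<times> 'a \<Rightarrow> bool" where
  "W_edge D e \<longleftrightarrow> e \<in> parcs D \<and> W_vertex D (fst e)"

definition E_edge :: "'a pair_pre_digraph \<Rightarrow> 'a \<times> 'a \<Rightarrow> bool" where
  "E_edge D e \<longleftrightarrow> e \<in> parcs D \<and> E_vertex D (snd e)"

definition inner_edge :: "'a pair_pre_digraph \<Rightarrow> 'a \<times> 'a \<Rightarrow> bool" where
  "inner_edge D e \<longleftrightarrow> e \<in> parcs D \<and> inner_vertex D (fst e) \<and> inner_vertex D (snd e)"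

definition functional_W_edge :: "'a pair_pre_digraph \<Rightarrow> 'a \<times> 'a \<Rightarrow> bool" where
  "functional_W_edge D e \<longleftrightarrow> W_edge D e \<and> (\<forall>c. (fst e, c) \<in> parcs D \<longrightarrow> c = snd e)"

definition functional_E_edge :: "'a pair_pre_digraph \<Rightarrow> 'a \<times> 'a \<Rightarrow> bool" where
  "functional_E_edge D e \<longleftrightarrow> E_edge D e \<and> (\<forall>c. (c, snd e) \<in> parcs D \<longrightarrow> c = fst e)"

datatype ns = North | South
datatype we = West | East

(* A node label: a graph with its distinguished edges; mark B North West is NW(B), and so on. *)
record 'a marked_graph =
  graph :: "'a pair_pre_digraph"
  mark :: "ns \<Rightarrow> we \<Rightarrow> 'a \<times> 'a"

definition basic_K_graph :: "'a marked_graph \<Rightarrow> bool" where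
  "basic_K_graph B \<longleftrightarrow>
     oriented_graph (graph B) \<and>
     (\<exists>A b C. A \<noteq> {} \<and> C \<noteq> {} \<and> b \<notin> A \<and> b \<notin> C \<and> A \<inter> C = {} \<and>
        graph B = \<lparr>pverts = A \<union> {b} \<union> C, parcs = A \<times> {b} \<union> {b} \<times> C\<rparr> \<and>
        (\<forall>Y. W_edge (graph B) (mark B Y West)) \<and>
        (\<forall>Y. E_edge (graph B) (mark B Y East)) \<and>
        (card A \<ge> 2 \<longrightarrow> mark B North West \<noteq> mark B South West) \<and>
        (card C \<ge> 2 \<longrightarrow> mark B North East \<noteq> mark B South East))"

definition new_edge :: "'a \<times> 'a \<Rightarrow> 'a \<times> 'a \<Rightarrow> 'a \<times> 'a" where
  "new_edge e\<^sub>W e\<^sub>E = (fst e\<^sub>W, snd e\<^sub>E)"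

definition graph_cut_defined ::
  "'a pair_pre_digraph \<Rightarrow> 'a \<times> 'a \<Rightarrow> 'a \<times> 'a \<Rightarrow> 'a pair_pre_digraph \<Rightarrow> bool" where
  "graph_cut_defined D\<^sub>W e\<^sub>W e\<^sub>E D\<^sub>E \<longleftrightarrow>
     oriented_graph D\<^sub>W \<and> oriented_graph D\<^sub>E \<and> pverts D\<^sub>W \<inter> pverts D\<^sub>E = {} \<and>
     functional_E_edge D\<^sub>W e\<^sub>W \<and> functional_W_edge D\<^sub>E e\<^sub>E"

definition graph_cut ::
  "'a pair_pre_digraph \<Rightarrow> 'a \<times> 'a \<Rightarrow> 'a \<times> 'a \<Rightarrow> 'a pair_pre_digraph \<Rightarrow> 'a pair_pre_digraph" where
  "graph_cut D\<^sub>W e\<^sub>W e\<^sub>E D\<^sub>E =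
     \<lparr>pverts = pverts D\<^sub>W \<union> pverts D\<^sub>E - {snd e\<^sub>W, fst e\<^sub>E},
      parcs = (parcs D\<^sub>W - {e\<^sub>W}) \<union> (parcs D\<^sub>E - {e\<^sub>E}) \<union> {new_edge e\<^sub>W e\<^sub>E}\<rparr>"

(* In Node L G\<^sub>W G\<^sub>E the first subtree is the west one. The cut edges are not stored: for a
   defined cut they can be read off from the vertices missing at the node. *)
datatype 'a ktree =
    Leaf "'a marked_graph"
  | Node "'a marked_graph" "'a ktree" "'a ktree"

primrec root_label :: "'a ktree \<Rightarrow> 'a marked_graph" where
  "root_label (Leaf B) = B"
| "root_label (Node L G\<^sub>W G\<^sub>E) = L"

abbreviation root_graph :: "'a ktree \<Rightarrow> 'a pair_pre_digraph" where
  "root_graph G \<equiv> graph (root_label G)"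

abbreviation root_mark :: "'a ktree \<Rightarrow> ns \<Rightarrow> we \<Rightarrow> 'a \<times> 'a" where
  "root_mark G \<equiv> mark (root_label G)"

definition cut_tree :: "'a ktree \<Rightarrow> 'a \<times> 'a \<Rightarrow> 'a \<times> 'a \<Rightarrow> 'a ktree \<Rightarrow> 'a ktree" where
  "cut_tree G\<^sub>W e\<^sub>W e\<^sub>E G\<^sub>E = Node
     \<lparr>graph = graph_cut (root_graph G\<^sub>W) e\<^sub>W e\<^sub>E (root_graph G\<^sub>E),
      mark = (\<lambda>Y X. case X of
          West \<Rightarrow> if e\<^sub>E = root_mark G\<^sub>E Y West then root_mark G\<^sub>W Y West else root_mark G\<^sub>E Y West
        | East \<Rightarrow> if e\<^sub>W = root_mark G\<^sub>W Y East then root_mark G\<^sub>E Y East else root_mark G\<^sub>W Y East)\<rparr>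
     G\<^sub>W G\<^sub>E"

definition cut_condition :: "'a ktree \<Rightarrow> 'a \<times> 'a \<Rightarrow> 'a \<times> 'a \<Rightarrow> 'a ktree \<Rightarrow> bool" where
  "cut_condition G\<^sub>W e\<^sub>W e\<^sub>E G\<^sub>E \<longleftrightarrow>
     graph_cut_defined (root_graph G\<^sub>W) e\<^sub>W e\<^sub>E (root_graph G\<^sub>E) \<and>
     (\<forall>Y. e\<^sub>W = root_mark G\<^sub>W Y East \<or> e\<^sub>E = root_mark G\<^sub>E Y West)"

inductive construction :: "'a ktree \<Rightarrow> bool" where
  basic: "basic_K_graph B \<Longrightarrow> construction (Leaf B)"
| cut: "\<lbrakk>construction G\<^sub>W; construction G\<^sub>E; cut_condition G\<^sub>W e\<^sub>W e\<^sub>E G\<^sub>E\<rbrakk>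
        \<Longrightarrow> construction (cut_tree G\<^sub>W e\<^sub>W e\<^sub>E G\<^sub>E)"

definition cut_defined :: "'a ktree \<Rightarrow> 'a \<times> 'a \<Rightarrow> 'a \<times> 'a \<Rightarrow> 'a ktree \<Rightarrow> bool" where
  "cut_defined G\<^sub>W e\<^sub>W e\<^sub>E G\<^sub>E \<longleftrightarrow>
     construction G\<^sub>W \<and> construction G\<^sub>E \<and> cut_condition G\<^sub>W e\<^sub>W e\<^sub>E G\<^sub>E"

inductive rho1 :: "'a ktree \<Rightarrow> 'a ktree \<Rightarrow> bool" where
  "\<lbrakk>cut_defined P e\<^sub>W e\<^sub>E Q; cut_defined (cut_tree P e\<^sub>W e\<^sub>E Q) f\<^sub>W f\<^sub>E R;
    cut_defined Q f\<^sub>W f\<^sub>E R; cut_defined P e\<^sub>W e\<^sub>E (cut_tree Q f\<^sub>W f\<^sub>E R)\<rbrakk>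
   \<Longrightarrow> rho1 (cut_tree (cut_tree P e\<^sub>W e\<^sub>E Q) f\<^sub>W f\<^sub>E R) (cut_tree P e\<^sub>W e\<^sub>E (cut_tree Q f\<^sub>W f\<^sub>E R))"

inductive rho2 :: "'a ktree \<Rightarrow> 'a ktree \<Rightarrow> bool" where
  "\<lbrakk>cut_defined P e\<^sub>W e\<^sub>E Q; cut_defined (cut_tree P e\<^sub>W e\<^sub>E Q) f\<^sub>W f\<^sub>E R;
    cut_defined P f\<^sub>W f\<^sub>E R; cut_defined (cut_tree P f\<^sub>W f\<^sub>E R) e\<^sub>W e\<^sub>E Q; e\<^sub>W \<noteq> f\<^sub>W\<rbrakk>
   \<Longrightarrow> rho2 (cut_tree (cut_tree P e\<^sub>W e\<^sub>E Q) f\<^sub>W f\<^sub>E R) (cut_tree (cut_tree P f\<^sub>W f\<^sub>E R) e\<^sub>W e\<^sub>E Q)"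

inductive rho3 :: "'a ktree \<Rightarrow> 'a ktree \<Rightarrow> bool" where
  "\<lbrakk>cut_defined Q e\<^sub>W e\<^sub>E P; cut_defined R f\<^sub>W f\<^sub>E (cut_tree Q e\<^sub>W e\<^sub>E P);
    cut_defined R f\<^sub>W f\<^sub>E P; cut_defined Q e\<^sub>W e\<^sub>E (cut_tree R f\<^sub>W f\<^sub>E P); e\<^sub>E \<noteq> f\<^sub>E\<rbrakk>
   \<Longrightarrow> rho3 (cut_tree R f\<^sub>W f\<^sub>E (cut_tree Q e\<^sub>W e\<^sub>E P)) (cut_tree Q e\<^sub>W e\<^sub>E (cut_tree R f\<^sub>W f\<^sub>E P))"

inductive rho_equivalent :: "'a ktree \<Rightarrow> 'a ktree \<Rightarrow> bool" where
  rho1: "rho1 G\<^sub>1 G\<^sub>2 \<Longrightarrow> rho_equivalent G\<^sub>1 G\<^sub>2"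
| rho2: "rho2 G\<^sub>1 G\<^sub>2 \<Longrightarrow> rho_equivalent G\<^sub>1 G\<^sub>2"
| rho3: "rho3 G\<^sub>1 G\<^sub>2 \<Longrightarrow> rho_equivalent G\<^sub>1 G\<^sub>2"
| refl: "construction G \<Longrightarrow> rho_equivalent G G"
| sym: "rho_equivalent G\<^sub>1 G\<^sub>2 \<Longrightarrow> rho_equivalent G\<^sub>2 G\<^sub>1"
| trans: "\<lbrakk>rho_equivalent G\<^sub>1 G\<^sub>2; rho_equivalent G\<^sub>2 G\<^sub>3\<rbrakk> \<Longrightarrow> rho_equivalent G\<^sub>1 G\<^sub>3"
| cong: "\<lbrakk>rho_equivalent G\<^sub>1 G\<^sub>2; rho_equivalent H\<^sub>1 H\<^sub>2;
          cut_defined G\<^sub>1 e\<^sub>W e\<^sub>E H\<^sub>1; cut_defined G\<^sub>2 e\<^sub>W e\<^sub>E H\<^sub>2\<rbrakk>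
         \<Longrightarrow> rho_equivalent (cut_tree G\<^sub>1 e\<^sub>W e\<^sub>E H\<^sub>1) (cut_tree G\<^sub>2 e\<^sub>W e\<^sub>E H\<^sub>2)"

(* A cut only needs its two root graphs to be disjoint, so a vertex omitted by one cut may be
   reused elsewhere in the tree. This can block regrouping: in (P[e]Q)[f]R, if a vertex of Q
   omitted by the first cut also occurs in R, then Q and R are not disjoint and P[e](Q[f]R)
   is undefined. no_clash is the convention that omitted vertices are not reused; for a
   construction it says that the graphs at distinct leaves are disjoint, which can always be
   achieved by renaming omitted vertices. *)
primrec all_verts :: "'a ktree \<Rightarrow> 'a set" where
  "all_verts (Leaf B) = pverts (graph B)"
| "all_verts (Node L G\<^sub>W G\<^sub>E) = pverts (graph L) \<union> all_verts G\<^sub>W \<union> all_verts G\<^sub>E"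

primrec no_clash :: "'a ktree \<Rightarrow> bool" where
  "no_clash (Leaf B) \<longleftrightarrow> True"
| "no_clash (Node L G\<^sub>W G\<^sub>E) \<longleftrightarrow>
     no_clash G\<^sub>W \<and> no_clash G\<^sub>E \<and> all_verts G\<^sub>W \<inter> all_verts G\<^sub>E = {}"

end

theory Submission
  imports Defs
begin

text \<open>By induction on the construction. An inner edge other than the one introduced by the last cut
  is already an inner edge of one of the two subtrees, which by induction can be rearranged so that
  this edge is introduced by its own last cut, without changing the label of its root. The two
  topmost cuts then have to be exchanged. Which of the three steps \<open>\<rho>\<^sub>1\<close>, \<open>\<rho>\<^sub>2\<close>, \<open>\<rho>\<^sub>3\<close> does
  this is decided by the part in which the edge of the old last cut lies; the required cuts are
  defined because no edge is both an E-edge and a W-edge, and because no clash occurs.\<close>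

section \<open>Oriented graphs and functional edges, pointwise\<close>

text \<open>Finiteness of the arcs, which \<open>pair_digraph\<close> also demands, follows from
  finiteness of the vertices. Antisymmetry without loops amounts to the absence of reversed
  arcs.\<close>

lemma oriented_graph_iff:
  "oriented_graph D \<longleftrightarrow> finite (pverts D) \<and> pverts D \<noteq> {} \<and>
     (\<forall>u v. (u, v) \<in> parcs D \<longrightarrow> u \<in> pverts D \<and> v \<in> pverts D \<and> u \<noteq> v \<and> (v, u) \<notin> parcs D)"
proof -
  have "finite (parcs D)" if "finite (pverts D)"
    "\<forall>u v. (u, v) \<in> parcs D \<longrightarrow> u \<in> pverts D \<and> v \<in> pverts D \<and> u \<noteq> v"
    by (rule finite_subset[of _ "pverts D \<times> pverts D"]) (use that in auto)
  then have "pair_digraph D \<longleftrightarrow> finite (pverts D) \<and>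
      (\<forall>u v. (u, v) \<in> parcs D \<longrightarrow> u \<in> pverts D \<and> v \<in> pverts D \<and> u \<noteq> v)"
    unfolding pair_digraph_def pair_fin_digraph_def pair_fin_digraph_axioms_def
      pair_loopfree_digraph_def pair_loopfree_digraph_axioms_def pair_wf_digraph_def
    by (auto simp: split_paired_all)
  then show ?thesis
    unfolding oriented_graph_def antisym_def by blast
qed

lemma functional_edge_arc:
  "functional_E_edge D f \<Longrightarrow> f \<in> parcs D"
  "functional_W_edge D f \<Longrightarrow> f \<in> parcs D"
  by (simp_all add: functional_E_edge_def E_edge_def functional_W_edge_def W_edge_def)

lemma functional_E_edge_iff:
  "functional_E_edge D (u, v) \<longleftrightarrow> (u, v) \<in> parcs D \<and> E_vertex D v \<and> (\<forall>w. (w, v) \<in> parcs D \<longrightarrow> w = u)"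
  by (auto simp: functional_E_edge_def E_edge_def)

lemma functional_W_edge_iff:
  "functional_W_edge D (u, v) \<longleftrightarrow> (u, v) \<in> parcs D \<and> W_vertex D u \<and> (\<forall>w. (u, w) \<in> parcs D \<longrightarrow> w = v)"
  by (auto simp: functional_W_edge_def W_edge_def)

section \<open>The effect of a cut on vertices and edges\<close>

text \<open>Both cut edges are given by their endpoints, so that adjacency in the cut can be
  computed vertex by vertex: \<open>b\<close> and \<open>c\<close> are the omitted vertices and
  \<open>(a, d)\<close> is the new edge.\<close>

locale cut_graphs =
  fixes D\<^sub>W :: "'a pair_pre_digraph" and a b c d :: 'a and D\<^sub>E :: "'a pair_pre_digraph"
  assumes defined: "graph_cut_defined D\<^sub>W (a, b) (c, d) D\<^sub>E"
begin

abbreviation D :: "'a pair_pre_digraph" where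
  "D \<equiv> graph_cut D\<^sub>W (a, b) (c, d) D\<^sub>E"

lemma oriented: "oriented_graph D\<^sub>W" "oriented_graph D\<^sub>E"
  using defined by (simp_all add: graph_cut_defined_def)

lemma disjoint: "v \<in> pverts D\<^sub>W \<Longrightarrow> v \<notin> pverts D\<^sub>E"
  using defined by (auto simp: graph_cut_defined_def)

lemma arcW: "(u, v) \<in> parcs D\<^sub>W \<Longrightarrow> u \<in> pverts D\<^sub>W \<and> v \<in> pverts D\<^sub>W \<and> u \<noteq> v \<and> (v, u) \<notin> parcs D\<^sub>W"
  using oriented(1) unfolding oriented_graph_iff by blast

lemma arcE: "(u, v) \<in> parcs D\<^sub>E \<Longrightarrow> u \<in> pverts D\<^sub>E \<and> v \<in> pverts D\<^sub>E \<and> u \<noteq> v \<and> (v, u) \<notin> parcs D\<^sub>E"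
  using oriented(2) unfolding oriented_graph_iff by blast

lemma ab: "(a, b) \<in> parcs D\<^sub>W" "(b, v) \<notin> parcs D\<^sub>W" "(v, b) \<in> parcs D\<^sub>W \<Longrightarrow> v = a"
  using defined
  by (auto simp: graph_cut_defined_def functional_E_edge_def E_edge_def E_vertex_def)

lemma cd: "(c, d) \<in> parcs D\<^sub>E" "(v, c) \<notin> parcs D\<^sub>E" "(c, v) \<in> parcs D\<^sub>E \<Longrightarrow> v = d"
  using defined
  by (auto simp: graph_cut_defined_def functional_W_edge_def W_edge_def W_vertex_def)

lemma D_verts: "v \<in> pverts D \<longleftrightarrow> v \<in> pverts D\<^sub>W \<and> v \<noteq> b \<or> v \<in> pverts D\<^sub>E \<and> v \<noteq> c"
  using disjoint[of b] disjoint[of c] disjoint[of v] arcW[OF ab(1)] arcE[OF cd(1)] by (auto simp: graph_cut_def)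

text \<open>By functionality \<open>(a, b)\<close> is the only edge ending in \<open>b\<close>, so
  removing this edge is the same as excluding the end \<open>b\<close>. Dually for
  \<open>(c, d)\<close> and the beginning \<open>c\<close>.\<close>

lemma D_arcs:
  "(u, v) \<in> parcs D \<longleftrightarrow> (u, v) \<in> parcs D\<^sub>W \<and> v \<noteq> b \<or> (u, v) \<in> parcs D\<^sub>E \<and> u \<noteq> c \<or> u = a \<and> v = d"
  by (auto simp: graph_cut_def new_edge_def ab(1) cd(1) dest: ab(3) cd(3))

text \<open>Knowing the half in which one endpoint lies leaves only the edges of that half and
  possibly \<open>(a, d)\<close>, the single edge that joins the two halves.\<close>

lemma arcs_from_W: "u \<in> pverts D\<^sub>W \<Longrightarrow> (u, v) \<in> parcs D \<longleftrightarrow> (u, v) \<in> parcs D\<^sub>W \<and> v \<noteq> b \<or> u = a \<and> v = d"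
  and arcs_from_E: "u \<in> pverts D\<^sub>E \<Longrightarrow> (u, v) \<in> parcs D \<longleftrightarrow> (u, v) \<in> parcs D\<^sub>E \<and> u \<noteq> c"
  and arcs_to_W: "v \<in> pverts D\<^sub>W \<Longrightarrow> (u, v) \<in> parcs D \<longleftrightarrow> (u, v) \<in> parcs D\<^sub>W \<and> v \<noteq> b"
  and arcs_to_E: "v \<in> pverts D\<^sub>E \<Longrightarrow> (u, v) \<in> parcs D \<longleftrightarrow> (u, v) \<in> parcs D\<^sub>E \<and> u \<noteq> c \<or> u = a \<and> v = d"
  using D_arcs[of u v] arcW[of u v] arcE[of u v] arcW[OF ab(1)] arcE[OF cd(1)] disjoint[of u] disjoint[of v]
  by auto

text \<open>The only outgoing edge lost in the western half is \<open>(a, b)\<close>, and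
  \<open>(a, d)\<close> makes up for it.\<close>

lemma ex_arc_from_W: "u \<in> pverts D\<^sub>W \<Longrightarrow> (\<exists>v. (u, v) \<in> parcs D) \<longleftrightarrow> (\<exists>v. (u, v) \<in> parcs D\<^sub>W)"
  using ab(1) ab(3)[of u] by (auto simp: arcs_from_W)

lemma ex_arc_to_E: "v \<in> pverts D\<^sub>E \<Longrightarrow> (\<exists>u. (u, v) \<in> parcs D) \<longleftrightarrow> (\<exists>u. (u, v) \<in> parcs D\<^sub>E)"
  using cd(1) cd(3)[of v] by (auto simp: arcs_to_E)

lemma oriented_cut: "oriented_graph D"
proof -
  have "finite (pverts D)"
    using oriented by (simp add: graph_cut_def oriented_graph_iff)
  \<comment> \<open>The vertex \<open>a\<close> survives the cut, since \<open>(a, b)\<close> is not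
    a loop.\<close>
  moreover have "pverts D \<noteq> {}"
    using D_verts[of a] ab(1) arcW[OF ab(1)] by blast
  moreover have "u \<in> pverts D \<and> v \<in> pverts D \<and> u \<noteq> v \<and> (v, u) \<notin> parcs D"
    if uv: "(u, v) \<in> parcs D" for u v
  proof -
    have "u \<noteq> c" "v \<noteq> b"
      using uv arcW[of u v] arcE[of u v] arcW[OF ab(1)] arcE[OF cd(1)] disjoint[of u] disjoint[of v]
      by (auto simp: D_arcs)
    moreover have "v \<noteq> c" "u \<noteq> b"
      using uv ab(2)[of v] cd(2)[of u] arcW[of u v] arcE[of u v] arcW[OF ab(1)] arcE[OF cd(1)] disjoint[of u] disjoint[of v]
      by (auto simp: D_arcs)
    \<comment> \<open>Two opposite edges would have to lie in the same half, because the only edge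
      between the halves runs from west to east.\<close>
    ultimately show ?thesis
      using uv arcW[of u v] arcE[of u v] arcW[of v u] arcE[of v u]
        arcW[OF ab(1)] arcE[OF cd(1)] disjoint[of u] disjoint[of v]
      unfolding D_arcs D_verts by auto
  qed
  ultimately show ?thesis
    by (auto simp: oriented_graph_iff)
qed

text \<open>Only \<open>b\<close> has to be excluded: the other omitted vertex \<open>c\<close>
  begins \<open>(c, d)\<close> and hence was no E-vertex.\<close>

lemma E_vertex_cut: "E_vertex D v \<longleftrightarrow> E_vertex D\<^sub>W v \<and> v \<noteq> b \<or> E_vertex D\<^sub>E v"
proof -
  consider "v \<in> pverts D\<^sub>W" "v \<notin> pverts D\<^sub>E" | "v \<in> pverts D\<^sub>E" "v \<notin> pverts D\<^sub>W"
    | "v \<notin> pverts D\<^sub>W" "v \<notin> pverts D\<^sub>E"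
    using disjoint by blast
  \<comment> \<open>Without \<open>not_ex\<close> the negated existential keeps the shape that
    \<open>ex_arc_from_W\<close> rewrites.\<close>
  then show ?thesis
    using cd(1) by cases (auto simp: E_vertex_def D_verts ex_arc_from_W arcs_from_E simp del: not_ex)
qed

lemma W_vertex_cut: "W_vertex D v \<longleftrightarrow> W_vertex D\<^sub>W v \<or> W_vertex D\<^sub>E v \<and> v \<noteq> c"
proof -
  consider "v \<in> pverts D\<^sub>W" "v \<notin> pverts D\<^sub>E" | "v \<in> pverts D\<^sub>E" "v \<notin> pverts D\<^sub>W"
    | "v \<notin> pverts D\<^sub>W" "v \<notin> pverts D\<^sub>E"
    using disjoint by blast
  then show ?thesis
    using ab(1) by cases (auto simp: W_vertex_def D_verts ex_arc_to_E arcs_to_W simp del: not_ex)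
qed

text \<open>The omitted \<open>b\<close> and \<open>c\<close> were an E-vertex and a W-vertex, so no
  inner vertex is lost; no vertex becomes inner either, because the cut leaves the type of every
  remaining vertex unchanged.\<close>

lemma inner_vertex_cut: "inner_vertex D v \<longleftrightarrow> inner_vertex D\<^sub>W v \<or> inner_vertex D\<^sub>E v"
proof -
  have "E_vertex D\<^sub>W b" "W_vertex D\<^sub>E c"
    using arcW[OF ab(1)] arcE[OF cd(1)] by (auto simp: ab(2) cd(2) E_vertex_def W_vertex_def)
  then show ?thesis
    using disjoint[of v] unfolding inner_vertex_def E_vertex_cut W_vertex_cut D_verts
    by (auto simp: E_vertex_def W_vertex_def)
qed

text \<open>Being a functional E-edge depends only on the end of the edge. At \<open>d\<close> the
  edge \<open>(c, d)\<close> is exchanged for \<open>(a, d)\<close>, which therefore inherits the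
  property from it; at every other remaining vertex the incoming edges stay the same.\<close>

lemma functional_E_edge_cut:
  "functional_E_edge D f \<longleftrightarrow> f = (a, d) \<and> functional_E_edge D\<^sub>E (c, d) \<or>
     f \<noteq> (a, b) \<and> functional_E_edge D\<^sub>W f \<or> f \<noteq> (c, d) \<and> functional_E_edge D\<^sub>E f"
proof (cases f)
  case (Pair x y)
  consider "y \<in> pverts D\<^sub>W" "y \<notin> pverts D\<^sub>E" | "y \<in> pverts D\<^sub>E" "y \<notin> pverts D\<^sub>W"
    | "y \<notin> pverts D\<^sub>W" "y \<notin> pverts D\<^sub>E"
    using disjoint[of y] by blast
  then show ?thesis
  proof cases
    case 1
    then have "\<not> functional_E_edge D\<^sub>E (u, y)" for u
      using arcE[of u y] by (auto simp: functional_E_edge_iff)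
    moreover have "y \<noteq> d" "\<not> E_vertex D\<^sub>E y" "(x, y) \<in> parcs D\<^sub>W \<Longrightarrow> y = b \<Longrightarrow> x = a"
      using 1 arcE[OF cd(1)] ab(3)[of x] by (auto simp: E_vertex_def)
    ultimately show ?thesis
      using 1 by (cases "y = b") (auto simp: Pair functional_E_edge_iff arcs_to_W E_vertex_cut)
  next
    case 2
    then have "\<not> functional_E_edge D\<^sub>W (u, y)" for u
      using arcW[of u y] by (auto simp: functional_E_edge_iff)
    moreover have "(a, y) \<notin> parcs D\<^sub>E" "\<not> E_vertex D\<^sub>W y" "a \<noteq> c" "y \<noteq> b"
      using 2 arcE[of a y] arcE[OF cd(1)] arcW[OF ab(1)] disjoint[of a] by (auto simp: E_vertex_def)
    ultimately have *: "\<not> functional_E_edge D\<^sub>W (u, y)" "(a, y) \<notin> parcs D\<^sub>E" "\<not> E_vertex D\<^sub>W y"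
      "a \<noteq> c" "y \<noteq> b" for u
      by blast+
    show ?thesis
    proof (cases "y = d")
      case True
      have "functional_E_edge D (x, y) \<longleftrightarrow> x = a \<and> E_vertex D\<^sub>E d \<and> (\<forall>w. (w, d) \<in> parcs D\<^sub>E \<longrightarrow> w = c)"
        using 2 * True by (auto simp: functional_E_edge_iff arcs_to_E E_vertex_cut)
      then show ?thesis
        using * True cd(1) by (auto simp: Pair functional_E_edge_iff)
    next
      case False
      then have "(w, y) \<in> parcs D \<longleftrightarrow> (w, y) \<in> parcs D\<^sub>E" for w
        using 2 cd(3)[of y] by (auto simp: arcs_to_E)
      then show ?thesis
        using * False by (simp add: Pair functional_E_edge_iff E_vertex_cut)
    qed
  next
    case 3
    then have "y \<noteq> d" "\<not> E_vertex D\<^sub>W y" "\<not> E_vertex D\<^sub>E y"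
      using arcE[OF cd(1)] by (auto simp: E_vertex_def)
    then show ?thesis
      by (simp add: Pair functional_E_edge_iff E_vertex_cut)
  qed
qed

text \<open>Dual to \<open>functional_E_edge_cut\<close>: now the beginning of the edge decides, and
  at \<open>a\<close> the new edge takes the place of \<open>(a, b)\<close>.\<close>

lemma functional_W_edge_cut:
  "functional_W_edge D f \<longleftrightarrow> f = (a, d) \<and> functional_W_edge D\<^sub>W (a, b) \<or>
     f \<noteq> (a, b) \<and> functional_W_edge D\<^sub>W f \<or> f \<noteq> (c, d) \<and> functional_W_edge D\<^sub>E f"
proof (cases f)
  case (Pair x y)
  consider "x \<in> pverts D\<^sub>W" "x \<notin> pverts D\<^sub>E" | "x \<in> pverts D\<^sub>E" "x \<notin> pverts D\<^sub>W"
    | "x \<notin> pverts D\<^sub>W" "x \<notin> pverts D\<^sub>E"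
    using disjoint[of x] by blast
  then show ?thesis
  proof cases
    case 2
    then have "\<not> functional_W_edge D\<^sub>W (x, v)" for v
      using arcW[of x v] by (auto simp: functional_W_edge_iff)
    moreover have "x \<noteq> a" "\<not> W_vertex D\<^sub>W x" "(x, y) \<in> parcs D\<^sub>E \<Longrightarrow> x = c \<Longrightarrow> y = d"
      using 2 arcW[OF ab(1)] cd(3)[of y] by (auto simp: W_vertex_def)
    ultimately show ?thesis
      using 2 by (cases "x = c") (auto simp: Pair functional_W_edge_iff arcs_from_E W_vertex_cut)
  next
    case 1
    then have "\<not> functional_W_edge D\<^sub>E (x, v)" for v
      using arcE[of x v] by (auto simp: functional_W_edge_iff)
    moreover have "(x, d) \<notin> parcs D\<^sub>W" "\<not> W_vertex D\<^sub>E x" "b \<noteq> d" "x \<noteq> c"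
      using 1 arcW[of x d] arcW[OF ab(1)] arcE[OF cd(1)] disjoint[of d] by (auto simp: W_vertex_def)
    ultimately have *: "\<not> functional_W_edge D\<^sub>E (x, v)" "(x, d) \<notin> parcs D\<^sub>W" "\<not> W_vertex D\<^sub>E x"
      "b \<noteq> d" "x \<noteq> c" for v
      by blast+
    show ?thesis
    proof (cases "x = a")
      case True
      have "functional_W_edge D (x, y) \<longleftrightarrow> y = d \<and> W_vertex D\<^sub>W a \<and> (\<forall>w. (a, w) \<in> parcs D\<^sub>W \<longrightarrow> w = b)"
        using 1 * True by (auto simp: functional_W_edge_iff arcs_from_W W_vertex_cut)
      then show ?thesis
        using * True ab(1) by (auto simp: Pair functional_W_edge_iff)
    next
      case False
      then have "(x, w) \<in> parcs D \<longleftrightarrow> (x, w) \<in> parcs D\<^sub>W" for w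
        using 1 ab(3)[of x] by (auto simp: arcs_from_W)
      then show ?thesis
        using * False by (simp add: Pair functional_W_edge_iff W_vertex_cut)
    qed
  next
    case 3
    then have "x \<noteq> a" "\<not> W_vertex D\<^sub>W x" "\<not> W_vertex D\<^sub>E x"
      using arcW[OF ab(1)] by (auto simp: W_vertex_def)
    then show ?thesis
      by (simp add: Pair functional_W_edge_iff W_vertex_cut)
  qed
qed

end

text \<open>Leads from the endpoints fixed in the locale back to edges as pairs, the form in which
  trees mention them.\<close>

lemma cut_graphs_if_defined:
  "graph_cut_defined D\<^sub>W e\<^sub>W e\<^sub>E D\<^sub>E \<Longrightarrow> cut_graphs D\<^sub>W (fst e\<^sub>W) (snd e\<^sub>W) (fst e\<^sub>E) (snd e\<^sub>E) D\<^sub>E"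
  by (simp add: cut_graphs_def)

lemmas oriented_graph_cut = cut_graphs.oriented_cut[OF cut_graphs_if_defined, simplified]
lemmas inner_vertex_graph_cut = cut_graphs.inner_vertex_cut[OF cut_graphs_if_defined, simplified]
lemmas functional_E_edge_graph_cut =
  cut_graphs.functional_E_edge_cut[OF cut_graphs_if_defined, simplified, folded new_edge_def]
lemmas functional_W_edge_graph_cut =
  cut_graphs.functional_W_edge_cut[OF cut_graphs_if_defined, simplified, folded new_edge_def]

lemma functional_edge_verts:
  assumes "oriented_graph D"
  shows "functional_E_edge D f \<Longrightarrow> fst f \<in> pverts D \<and> snd f \<in> pverts D"
    and "functional_W_edge D f \<Longrightarrow> fst f \<in> pverts D \<and> snd f \<in> pverts D"
  using assms by (cases f; auto simp: oriented_graph_iff dest: functional_edge_arc)+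

section \<open>Labels and vertices of cut trees\<close>

lemma root_graph_cut_tree [simp]:
  "root_graph (cut_tree G\<^sub>W e\<^sub>W e\<^sub>E G\<^sub>E) = graph_cut (root_graph G\<^sub>W) e\<^sub>W e\<^sub>E (root_graph G\<^sub>E)"
  by (simp add: cut_tree_def)

lemma root_mark_cut_tree [simp]:
  "root_mark (cut_tree G\<^sub>W e\<^sub>W e\<^sub>E G\<^sub>E) Y West =
     (if e\<^sub>E = root_mark G\<^sub>E Y West then root_mark G\<^sub>W Y West else root_mark G\<^sub>E Y West)"
  "root_mark (cut_tree G\<^sub>W e\<^sub>W e\<^sub>E G\<^sub>E) Y East =
     (if e\<^sub>W = root_mark G\<^sub>W Y East then root_mark G\<^sub>E Y East else root_mark G\<^sub>W Y East)"
  by (simp_all add: cut_tree_def)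

text \<open>Lets a subtree be replaced by a rearranged one with the same label.\<close>

lemma root_label_cut_tree_cong:
  assumes "root_label G = root_label G'" "root_label H = root_label H'"
  shows "root_label (cut_tree G e\<^sub>W e\<^sub>E H) = root_label (cut_tree G' e\<^sub>W e\<^sub>E H')"
  unfolding cut_tree_def root_label.simps assms ..

lemma root_label_eqI:
  fixes G H :: "'a ktree"
  assumes "root_graph G = root_graph H"
    and "\<And>Y. root_mark G Y West = root_mark H Y West" "\<And>Y. root_mark G Y East = root_mark H Y East"
  shows "root_label G = root_label H"
proof -
  have "root_mark G Y X = root_mark H Y X" for Y X
    using assms by (cases X) auto
  then have "root_mark G = root_mark H"
    by blast
  with assms(1) show ?thesis
    by (cases "root_label G"; cases "root_label H") simp
qed

lemma all_verts_cut_tree: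
  "all_verts (cut_tree G\<^sub>W e\<^sub>W e\<^sub>E G\<^sub>E) = all_verts G\<^sub>W \<union> all_verts G\<^sub>E"
proof -
  have "pverts (root_graph G) \<subseteq> all_verts G" for G :: "'a ktree"
    by (cases G) auto
  from this[of G\<^sub>W] this[of G\<^sub>E] show ?thesis
    by (auto simp: cut_tree_def graph_cut_def)
qed

lemma no_clash_cut_tree:
  "no_clash (cut_tree G\<^sub>W e\<^sub>W e\<^sub>E G\<^sub>E) \<longleftrightarrow>
     no_clash G\<^sub>W \<and> no_clash G\<^sub>E \<and> all_verts G\<^sub>W \<inter> all_verts G\<^sub>E = {}"
  by (simp add: cut_tree_def)

lemma root_verts_disjoint:
  assumes "all_verts G \<inter> all_verts H = {}"
  shows "pverts (root_graph G) \<inter> pverts (root_graph H) = {}"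
proof -
  have "pverts (root_graph G) \<subseteq> all_verts G" for G :: "'a ktree"
    by (cases G) auto
  with assms show ?thesis
    by blast
qed

section \<open>Invariants of constructions\<close>

text \<open>Every edge is incident with the centre \<open>b\<close>: those into it are the
  functional W-edges, those out of it the functional E-edges. As \<open>b\<close> is the only inner
  vertex, an inner edge would be a loop.\<close>

lemma basic_K_graph_edges:
  assumes "basic_K_graph B"
  shows "\<not> (functional_E_edge (graph B) f \<and> functional_W_edge (graph B) f)"
    and "functional_E_edge (graph B) (mark B Y East)"
    and "functional_W_edge (graph B) (mark B Y West)"
    and "\<not> inner_edge (graph B) f"
proof -
  obtain A b C where B: "A \<noteq> {}" "C \<noteq> {}" "b \<notin> A" "b \<notin> C" "A \<inter> C = {}"
      "graph B = \<lparr>pverts = A \<union> {b} \<union> C, parcs = A \<times> {b} \<union> {b} \<times> C\<rparr>"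
      "W_edge (graph B) (mark B Y West)" "E_edge (graph B) (mark B Y East)"
    using assms unfolding basic_K_graph_def by blast
  have E: "E_vertex (graph B) v \<longleftrightarrow> v \<in> C" and W: "W_vertex (graph B) v \<longleftrightarrow> v \<in> A" for v
    using B(1-5) by (auto simp: E_vertex_def W_vertex_def B(6))
  have arcs: "(u, v) \<in> parcs (graph B) \<longleftrightarrow> u \<in> A \<and> v = b \<or> u = b \<and> v \<in> C" for u v
    by (auto simp: B(6))
  have fE: "functional_E_edge (graph B) (u, v) \<longleftrightarrow> u = b \<and> v \<in> C" for u v
    using B(4,5) by (auto simp: functional_E_edge_iff arcs E)
  have fW: "functional_W_edge (graph B) (u, v) \<longleftrightarrow> u \<in> A \<and> v = b" for u v
    using B(3,5) by (auto simp: functional_W_edge_iff arcs W)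
  show "\<not> (functional_E_edge (graph B) f \<and> functional_W_edge (graph B) f)"
    using B(3) by (cases f) (auto simp: fE fW)
  show "functional_E_edge (graph B) (mark B Y East)"
    using B(4,8) by (cases "mark B Y East") (auto simp: fE E_edge_def E arcs)
  show "functional_W_edge (graph B) (mark B Y West)"
    using B(3,7) by (cases "mark B Y West") (auto simp: fW W_edge_def W arcs)
  show "\<not> inner_edge (graph B) f"
    by (cases f) (auto simp: inner_edge_def inner_vertex_def E W arcs)
qed

text \<open>The parts of the invariant support each other. That no edge is functional on both sides
  guarantees that a cut never deletes a mark that is passed on to the new root, and the induction
  needs it for both halves.\<close>

lemma construction_invariants:
  assumes "construction G"
  shows "oriented_graph (root_graph G) \<and>
    (\<forall>f. \<not> (functional_E_edge (root_graph G) f \<and> functional_W_edge (root_graph G) f)) \<and>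
    (\<forall>Y. functional_E_edge (root_graph G) (root_mark G Y East) \<and>
         functional_W_edge (root_graph G) (root_mark G Y West))"
  using assms
proof induction
  case (basic B)
  then show ?case
    using basic_K_graph_edges[OF basic] by (simp add: basic_K_graph_def)
next
  case (cut G\<^sub>W G\<^sub>E e\<^sub>W e\<^sub>E)
  note def = cut.hyps(3)[unfolded cut_condition_def, THEN conjunct1]
  note E = functional_E_edge_graph_cut[OF def] and W = functional_W_edge_graph_cut[OF def]
  have e: "functional_E_edge (root_graph G\<^sub>W) e\<^sub>W" "functional_W_edge (root_graph G\<^sub>E) e\<^sub>E"
    "pverts (root_graph G\<^sub>W) \<inter> pverts (root_graph G\<^sub>E) = {}"
    using def by (simp_all add: graph_cut_defined_def)
  have "\<not> (functional_E_edge (root_graph G\<^sub>W) f \<and> functional_W_edge (root_graph G\<^sub>E) f)"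
    "\<not> (functional_W_edge (root_graph G\<^sub>W) f \<and> functional_E_edge (root_graph G\<^sub>E) f)" for f
    using functional_edge_verts[of "root_graph G\<^sub>W" f] functional_edge_verts[of "root_graph G\<^sub>E" f]
      cut.IH e(3) by blast+
  \<comment> \<open>The new edge is functional on neither side: as an E-edge it would require
    \<open>e\<^sub>E\<close> to be a functional E-edge as well as a functional W-edge, and dually
    for \<open>e\<^sub>W\<close>.\<close>
  then have "\<not> (functional_E_edge (root_graph (cut_tree G\<^sub>W e\<^sub>W e\<^sub>E G\<^sub>E)) f \<and>
      functional_W_edge (root_graph (cut_tree G\<^sub>W e\<^sub>W e\<^sub>E G\<^sub>E)) f)" for f
    using cut.IH e unfolding root_graph_cut_tree E W by blast
  moreover have ne: "root_mark G\<^sub>E Y East \<noteq> e\<^sub>E" "root_mark G\<^sub>W Y West \<noteq> e\<^sub>W" for Y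
    using cut.IH e(1,2) by metis+
  moreover have "functional_E_edge (root_graph (cut_tree G\<^sub>W e\<^sub>W e\<^sub>E G\<^sub>E))
      (root_mark (cut_tree G\<^sub>W e\<^sub>W e\<^sub>E G\<^sub>E) Y East)" for Y
    using cut.IH ne[of Y] unfolding root_graph_cut_tree E by simp
  moreover have "functional_W_edge (root_graph (cut_tree G\<^sub>W e\<^sub>W e\<^sub>E G\<^sub>E))
      (root_mark (cut_tree G\<^sub>W e\<^sub>W e\<^sub>E G\<^sub>E) Y West)" for Y
    using cut.IH ne[of Y] unfolding root_graph_cut_tree W by simp
  ultimately show ?case
    using oriented_graph_cut[OF def] by simp
qed

lemma cut_defined_iff:
  "cut_defined G\<^sub>W e\<^sub>W e\<^sub>E G\<^sub>E \<longleftrightarrow> construction G\<^sub>W \<and> construction G\<^sub>E \<and>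
     pverts (root_graph G\<^sub>W) \<inter> pverts (root_graph G\<^sub>E) = {} \<and>
     functional_E_edge (root_graph G\<^sub>W) e\<^sub>W \<and> functional_W_edge (root_graph G\<^sub>E) e\<^sub>E \<and>
     (\<forall>Y. e\<^sub>W = root_mark G\<^sub>W Y East \<or> e\<^sub>E = root_mark G\<^sub>E Y West)"
  using construction_invariants[of G\<^sub>W] construction_invariants[of G\<^sub>E]
  by (auto simp: cut_defined_def cut_condition_def graph_cut_defined_def)

lemma cut_defined_graph_cut:
  "cut_defined G\<^sub>W e\<^sub>W e\<^sub>E G\<^sub>E \<Longrightarrow> graph_cut_defined (root_graph G\<^sub>W) e\<^sub>W e\<^sub>E (root_graph G\<^sub>E)"
  by (simp add: cut_defined_def cut_condition_def)

lemma cut_defined_construction: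
  "cut_defined G\<^sub>W e\<^sub>W e\<^sub>E G\<^sub>E \<Longrightarrow> construction (cut_tree G\<^sub>W e\<^sub>W e\<^sub>E G\<^sub>E)"
  by (simp add: cut_defined_def construction.cut)

text \<open>Between constructions, whether a cut is defined can be seen from the root labels
  alone.\<close>

lemma cut_defined_cong:
  assumes "construction G'" "construction H'"
    and "root_label G = root_label G'" "root_label H = root_label H'"
    and "cut_defined G e\<^sub>W e\<^sub>E H"
  shows "cut_defined G' e\<^sub>W e\<^sub>E H'"
  using assms by (simp add: cut_defined_iff)

lemma cut_edge_verts:
  assumes "cut_defined G\<^sub>W e\<^sub>W e\<^sub>E G\<^sub>E"
  shows "fst e\<^sub>W \<in> pverts (root_graph G\<^sub>W)" "snd e\<^sub>W \<in> pverts (root_graph G\<^sub>W)"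
    and "fst e\<^sub>E \<in> pverts (root_graph G\<^sub>E)" "snd e\<^sub>E \<in> pverts (root_graph G\<^sub>E)"
  using assms functional_edge_verts[of "root_graph G\<^sub>W" e\<^sub>W] functional_edge_verts[of "root_graph G\<^sub>E" e\<^sub>E]
    construction_invariants[of G\<^sub>W] construction_invariants[of G\<^sub>E]
  by (simp_all add: cut_defined_iff)

lemma mark_verts:
  assumes "construction G"
  shows "fst (root_mark G Y X) \<in> pverts (root_graph G)"
  using construction_invariants[OF assms] functional_edge_verts[of "root_graph G" "root_mark G Y X"]
  by (cases X) auto

lemma functional_edges_distinct:
  assumes "construction G" "functional_E_edge (root_graph G) e" "functional_W_edge (root_graph G) f"
  shows "e \<noteq> f"
  using construction_invariants[OF assms(1)] assms(2,3) by blast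

section \<open>Two cuts in either order yield the same root label\<close>

lemma graph_cut_assoc:
  assumes "pverts P \<inter> pverts Q = {}" "pverts P \<inter> pverts R = {}" "pverts Q \<inter> pverts R = {}"
    and "oriented_graph P" "oriented_graph Q" "oriented_graph R"
    and "fst e\<^sub>W \<in> pverts P" "snd e\<^sub>W \<in> pverts P" "fst e\<^sub>E \<in> pverts Q" "snd e\<^sub>E \<in> pverts Q"
    and "fst f\<^sub>W \<in> pverts Q" "snd f\<^sub>W \<in> pverts Q" "fst f\<^sub>E \<in> pverts R" "snd f\<^sub>E \<in> pverts R"
  shows "graph_cut (graph_cut P e\<^sub>W e\<^sub>E Q) f\<^sub>W f\<^sub>E R = graph_cut P e\<^sub>W e\<^sub>E (graph_cut Q f\<^sub>W f\<^sub>E R)"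
proof -
  \<comment> \<open>Both sides are the same union with the same removals, provided that neither cut
    removes anything from the graph it does not involve, nor the edge introduced by the other
    cut.\<close>
  have "f\<^sub>W \<notin> parcs P" "e\<^sub>E \<notin> parcs R"
    using assms by (metis disjoint_iff oriented_graph_iff prod.collapse)+
  moreover have "snd e\<^sub>W \<notin> pverts R" "fst e\<^sub>E \<notin> pverts R" "snd f\<^sub>W \<notin> pverts P" "fst f\<^sub>E \<notin> pverts P"
    using assms by blast+
  \<comment> \<open>The first two edges begin in different graphs, \<open>P\<close> and
    \<open>Q\<close>; the last two end in different graphs, \<open>R\<close> and
    \<open>Q\<close>.\<close>
  moreover have "new_edge e\<^sub>W e\<^sub>E \<noteq> f\<^sub>W" "new_edge f\<^sub>W f\<^sub>E \<noteq> e\<^sub>E"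
    using assms unfolding new_edge_def by (metis disjoint_iff fst_conv snd_conv)+
  ultimately show ?thesis
    unfolding graph_cut_def by (intro pair_pre_digraph.equality) (simp_all, blast+)
qed

lemma graph_cut_commute_E:
  assumes "pverts P \<inter> pverts Q = {}" "pverts P \<inter> pverts R = {}" "pverts Q \<inter> pverts R = {}"
    and "oriented_graph P" "oriented_graph Q" "oriented_graph R"
    and "fst e\<^sub>W \<in> pverts P" "snd e\<^sub>W \<in> pverts P" "fst e\<^sub>E \<in> pverts Q" "snd e\<^sub>E \<in> pverts Q"
    and "fst f\<^sub>W \<in> pverts P" "snd f\<^sub>W \<in> pverts P" "fst f\<^sub>E \<in> pverts R" "snd f\<^sub>E \<in> pverts R"
  shows "graph_cut (graph_cut P e\<^sub>W e\<^sub>E Q) f\<^sub>W f\<^sub>E R = graph_cut (graph_cut P f\<^sub>W f\<^sub>E R) e\<^sub>W e\<^sub>E Q"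
proof -
  have "f\<^sub>W \<notin> parcs Q" "e\<^sub>W \<notin> parcs R"
    using assms by (metis disjoint_iff oriented_graph_iff prod.collapse)+
  moreover have "snd e\<^sub>W \<notin> pverts R" "fst e\<^sub>E \<notin> pverts R" "snd f\<^sub>W \<notin> pverts Q" "fst f\<^sub>E \<notin> pverts Q"
    using assms by blast+
  moreover have "new_edge e\<^sub>W e\<^sub>E \<noteq> f\<^sub>W" "new_edge f\<^sub>W f\<^sub>E \<noteq> e\<^sub>W"
    using assms unfolding new_edge_def by (metis disjoint_iff fst_conv snd_conv)+
  ultimately show ?thesis
    unfolding graph_cut_def by (intro pair_pre_digraph.equality) (simp_all, blast+)
qed

lemma graph_cut_commute_W:
  assumes "pverts P \<inter> pverts Q = {}" "pverts P \<inter> pverts R = {}" "pverts Q \<inter> pverts R = {}"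
    and "oriented_graph P" "oriented_graph Q" "oriented_graph R"
    and "fst e\<^sub>W \<in> pverts Q" "snd e\<^sub>W \<in> pverts Q" "fst e\<^sub>E \<in> pverts P" "snd e\<^sub>E \<in> pverts P"
    and "fst f\<^sub>W \<in> pverts R" "snd f\<^sub>W \<in> pverts R" "fst f\<^sub>E \<in> pverts P" "snd f\<^sub>E \<in> pverts P"
  shows "graph_cut R f\<^sub>W f\<^sub>E (graph_cut Q e\<^sub>W e\<^sub>E P) = graph_cut Q e\<^sub>W e\<^sub>E (graph_cut R f\<^sub>W f\<^sub>E P)"
proof -
  have "f\<^sub>E \<notin> parcs Q" "e\<^sub>E \<notin> parcs R"
    using assms by (metis disjoint_iff oriented_graph_iff prod.collapse)+
  moreover have "fst e\<^sub>E \<notin> pverts R" "snd e\<^sub>W \<notin> pverts R" "fst f\<^sub>E \<notin> pverts Q" "snd f\<^sub>W \<notin> pverts Q"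
    using assms by blast+
  moreover have "new_edge e\<^sub>W e\<^sub>E \<noteq> f\<^sub>E" "new_edge f\<^sub>W f\<^sub>E \<noteq> e\<^sub>E"
    using assms unfolding new_edge_def by (metis disjoint_iff fst_conv snd_conv)+
  ultimately show ?thesis
    unfolding graph_cut_def by (intro pair_pre_digraph.equality) (simp_all, blast+)
qed

text \<open>Here \<open>V\<close> stands for the vertices of another part: a mark begins in its own
  part, so it cannot be an edge beginning in a disjoint one.\<close>

lemma mark_neq:
  assumes "construction G" "pverts (root_graph G) \<inter> V = {}" "fst e \<in> V"
  shows "root_mark G Y X \<noteq> e"
  using mark_verts[OF assms(1), of Y X] assms(2,3) by auto

lemma pverts_graph_cut: "pverts (graph_cut D\<^sub>W e\<^sub>W e\<^sub>E D\<^sub>E) \<subseteq> pverts D\<^sub>W \<union> pverts D\<^sub>E"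
  by (auto simp: graph_cut_def)

lemma root_label_cut_assoc:
  assumes "cut_defined P e\<^sub>W e\<^sub>E Q" "cut_defined Q f\<^sub>W f\<^sub>E R"
    and "pverts (root_graph P) \<inter> pverts (root_graph R) = {}"
  shows "root_label (cut_tree (cut_tree P e\<^sub>W e\<^sub>E Q) f\<^sub>W f\<^sub>E R) =
    root_label (cut_tree P e\<^sub>W e\<^sub>E (cut_tree Q f\<^sub>W f\<^sub>E R))"
proof (rule root_label_eqI)
  note c = assms(1,2)[unfolded cut_defined_iff]
    cut_edge_verts[OF assms(1)] cut_edge_verts[OF assms(2)]
  show "root_graph (cut_tree (cut_tree P e\<^sub>W e\<^sub>E Q) f\<^sub>W f\<^sub>E R) =
      root_graph (cut_tree P e\<^sub>W e\<^sub>E (cut_tree Q f\<^sub>W f\<^sub>E R))"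
    unfolding root_graph_cut_tree
    by (rule graph_cut_assoc) (use c assms(3) construction_invariants in auto)
  fix Y
  \<comment> \<open>Marks of the outer parts \<open>P\<close> and \<open>R\<close> are never
    mistaken for an edge of the cut in which that part is not involved, so the nested choices of
    marks agree.\<close>
  have "root_mark P Y East \<noteq> f\<^sub>W" "root_mark R Y West \<noteq> e\<^sub>E"
    by (rule mark_neq; use c in blast)+
  then show "root_mark (cut_tree (cut_tree P e\<^sub>W e\<^sub>E Q) f\<^sub>W f\<^sub>E R) Y West =
      root_mark (cut_tree P e\<^sub>W e\<^sub>E (cut_tree Q f\<^sub>W f\<^sub>E R)) Y West"
    and "root_mark (cut_tree (cut_tree P e\<^sub>W e\<^sub>E Q) f\<^sub>W f\<^sub>E R) Y East =
      root_mark (cut_tree P e\<^sub>W e\<^sub>E (cut_tree Q f\<^sub>W f\<^sub>E R)) Y East"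
    by auto
qed

lemma root_label_cut_commute_E:
  assumes "cut_defined P e\<^sub>W e\<^sub>E Q" "cut_defined P f\<^sub>W f\<^sub>E R" "e\<^sub>W \<noteq> f\<^sub>W"
    and "pverts (root_graph Q) \<inter> pverts (root_graph R) = {}"
  shows "root_label (cut_tree (cut_tree P e\<^sub>W e\<^sub>E Q) f\<^sub>W f\<^sub>E R) =
    root_label (cut_tree (cut_tree P f\<^sub>W f\<^sub>E R) e\<^sub>W e\<^sub>E Q)"
proof (rule root_label_eqI)
  note c = assms(1,2)[unfolded cut_defined_iff]
    cut_edge_verts[OF assms(1)] cut_edge_verts[OF assms(2)]
  show "root_graph (cut_tree (cut_tree P e\<^sub>W e\<^sub>E Q) f\<^sub>W f\<^sub>E R) =
      root_graph (cut_tree (cut_tree P f\<^sub>W f\<^sub>E R) e\<^sub>W e\<^sub>E Q)"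
    unfolding root_graph_cut_tree
    by (rule graph_cut_commute_E) (use c assms(4) construction_invariants in auto)
  fix Y
  have "root_mark Q Y East \<noteq> f\<^sub>W" "root_mark R Y East \<noteq> e\<^sub>W"
    by (rule mark_neq; use c in blast)+
  \<comment> \<open>The different edges \<open>e\<^sub>W\<close> and \<open>f\<^sub>W\<close> cannot
    both be the east mark of \<open>P\<close>, so one of the two cut conditions must hold through
    its other alternative. Otherwise \<open>Q\<close> and \<open>R\<close> would compete for the
    west mark, and the order of the cuts would matter.\<close>
  moreover have "e\<^sub>E = root_mark Q Y West \<or> f\<^sub>E = root_mark R Y West"
    using c(1,2) assms(3) by metis
  ultimately show "root_mark (cut_tree (cut_tree P e\<^sub>W e\<^sub>E Q) f\<^sub>W f\<^sub>E R) Y West =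
      root_mark (cut_tree (cut_tree P f\<^sub>W f\<^sub>E R) e\<^sub>W e\<^sub>E Q) Y West"
    and "root_mark (cut_tree (cut_tree P e\<^sub>W e\<^sub>E Q) f\<^sub>W f\<^sub>E R) Y East =
      root_mark (cut_tree (cut_tree P f\<^sub>W f\<^sub>E R) e\<^sub>W e\<^sub>E Q) Y East"
    using assms(3) by auto
qed

lemma root_label_cut_commute_W:
  assumes "cut_defined Q e\<^sub>W e\<^sub>E P" "cut_defined R f\<^sub>W f\<^sub>E P" "e\<^sub>E \<noteq> f\<^sub>E"
    and "pverts (root_graph Q) \<inter> pverts (root_graph R) = {}"
  shows "root_label (cut_tree R f\<^sub>W f\<^sub>E (cut_tree Q e\<^sub>W e\<^sub>E P)) =
    root_label (cut_tree Q e\<^sub>W e\<^sub>E (cut_tree R f\<^sub>W f\<^sub>E P))"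
proof (rule root_label_eqI)
  note c = assms(1,2)[unfolded cut_defined_iff]
    cut_edge_verts[OF assms(1)] cut_edge_verts[OF assms(2)]
  show "root_graph (cut_tree R f\<^sub>W f\<^sub>E (cut_tree Q e\<^sub>W e\<^sub>E P)) =
      root_graph (cut_tree Q e\<^sub>W e\<^sub>E (cut_tree R f\<^sub>W f\<^sub>E P))"
    unfolding root_graph_cut_tree
    by (rule graph_cut_commute_W) (use c assms(4) construction_invariants in auto)
  fix Y
  have "root_mark Q Y West \<noteq> f\<^sub>E" "root_mark R Y West \<noteq> e\<^sub>E"
    by (rule mark_neq; use c in blast)+
  \<comment> \<open>Dually, only one of \<open>e\<^sub>E\<close> and \<open>f\<^sub>E\<close> can be
    the west mark of \<open>P\<close>, which settles the east mark.\<close>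
  moreover have "e\<^sub>W = root_mark Q Y East \<or> f\<^sub>W = root_mark R Y East"
    using c(1,2) assms(3) by metis
  ultimately show "root_mark (cut_tree R f\<^sub>W f\<^sub>E (cut_tree Q e\<^sub>W e\<^sub>E P)) Y West =
      root_mark (cut_tree Q e\<^sub>W e\<^sub>E (cut_tree R f\<^sub>W f\<^sub>E P)) Y West"
    and "root_mark (cut_tree R f\<^sub>W f\<^sub>E (cut_tree Q e\<^sub>W e\<^sub>E P)) Y East =
      root_mark (cut_tree Q e\<^sub>W e\<^sub>E (cut_tree R f\<^sub>W f\<^sub>E P)) Y East"
    using assms(3) by auto
qed

section \<open>Definedness of the exchanged cuts\<close>

text \<open>Supplies the premises of \<open>rho1\<close>. Apart from disjointness, the edge
  \<open>e\<^sub>E\<close> must survive the cut of \<open>Q\<close> with \<open>R\<close> and the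
  mark conditions must carry over.\<close>

lemma cut_assoc_right:
  assumes PQ: "cut_defined P e\<^sub>W e\<^sub>E Q" and PQR: "cut_defined (cut_tree P e\<^sub>W e\<^sub>E Q) f\<^sub>W f\<^sub>E R"
    and f: "functional_E_edge (root_graph Q) f\<^sub>W"
    and disj: "pverts (root_graph P) \<inter> pverts (root_graph R) = {}"
      "pverts (root_graph Q) \<inter> pverts (root_graph R) = {}"
  shows "cut_defined Q f\<^sub>W f\<^sub>E R" "cut_defined P e\<^sub>W e\<^sub>E (cut_tree Q f\<^sub>W f\<^sub>E R)"
proof -
  note c = PQ[unfolded cut_defined_iff] PQR[unfolded cut_defined_iff]
  have v: "fst e\<^sub>E \<in> pverts (root_graph Q)" "fst f\<^sub>W \<in> pverts (root_graph Q)"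
    using cut_edge_verts[OF PQ] functional_edge_verts f c(1)
      construction_invariants[of Q] by blast+
  have n: "root_mark P Y East \<noteq> f\<^sub>W" "root_mark R Y West \<noteq> e\<^sub>E" for Y
    by (rule mark_neq; use c v disj in blast)+
  show QR: "cut_defined Q f\<^sub>W f\<^sub>E R"
    unfolding cut_defined_iff
  proof (intro conjI allI)
    fix Y
    show "f\<^sub>W = root_mark Q Y East \<or> f\<^sub>E = root_mark R Y West"
      using c(2) n(1)[of Y] by (auto split: if_splits)
  qed (use c f disj in auto)
  \<comment> \<open>One edge of \<open>Q\<close> cannot serve both cuts, hence cutting at
    \<open>f\<^sub>W\<close> leaves \<open>e\<^sub>E\<close> in place.\<close>
  have "e\<^sub>E \<noteq> f\<^sub>W"
    using functional_edges_distinct f c(1) by blast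
  show "cut_defined P e\<^sub>W e\<^sub>E (cut_tree Q f\<^sub>W f\<^sub>E R)"
    unfolding cut_defined_iff
  proof (intro conjI allI)
    fix Y
    \<comment> \<open>If \<open>e\<^sub>W\<close> is not the east mark of \<open>P\<close>, that
      mark passes to the cut of \<open>P\<close> and \<open>Q\<close> and differs from
      \<open>f\<^sub>W\<close>. So \<open>f\<^sub>E\<close> is the west mark of \<open>R\<close>,
      and the cut of \<open>Q\<close> and \<open>R\<close> takes its west mark from
      \<open>Q\<close>, where it is \<open>e\<^sub>E\<close>.\<close>
    show "e\<^sub>W = root_mark P Y East \<or> e\<^sub>E = root_mark (cut_tree Q f\<^sub>W f\<^sub>E R) Y West"
      using c n[of Y] by (auto split: if_splits)
    show "functional_W_edge (root_graph (cut_tree Q f\<^sub>W f\<^sub>E R)) e\<^sub>E"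
      using c(1) \<open>e\<^sub>E \<noteq> f\<^sub>W\<close> functional_W_edge_graph_cut[OF cut_defined_graph_cut[OF QR]] by simp
    show "pverts (root_graph P) \<inter> pverts (root_graph (cut_tree Q f\<^sub>W f\<^sub>E R)) = {}"
      using c(1) disj pverts_graph_cut[of "root_graph Q" f\<^sub>W f\<^sub>E "root_graph R"] by auto
  qed (use c cut_defined_construction[OF QR] in auto)
qed

lemma cut_assoc_left:
  assumes QR: "cut_defined Q f\<^sub>W f\<^sub>E R" and PQR: "cut_defined P e\<^sub>W e\<^sub>E (cut_tree Q f\<^sub>W f\<^sub>E R)"
    and e: "functional_W_edge (root_graph Q) e\<^sub>E"
    and disj: "pverts (root_graph P) \<inter> pverts (root_graph Q) = {}"
      "pverts (root_graph P) \<inter> pverts (root_graph R) = {}"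
  shows "cut_defined P e\<^sub>W e\<^sub>E Q" "cut_defined (cut_tree P e\<^sub>W e\<^sub>E Q) f\<^sub>W f\<^sub>E R"
proof -
  note c = QR[unfolded cut_defined_iff] PQR[unfolded cut_defined_iff]
  have v: "fst e\<^sub>E \<in> pverts (root_graph Q)" "fst f\<^sub>W \<in> pverts (root_graph Q)"
    using cut_edge_verts[OF QR] functional_edge_verts e c(1)
      construction_invariants[of Q] by blast+
  have n: "root_mark P Y East \<noteq> f\<^sub>W" "root_mark R Y West \<noteq> e\<^sub>E" for Y
    by (rule mark_neq; use c v disj in blast)+
  show PQ: "cut_defined P e\<^sub>W e\<^sub>E Q"
    unfolding cut_defined_iff
  proof (intro conjI allI)
    fix Y
    show "e\<^sub>W = root_mark P Y East \<or> e\<^sub>E = root_mark Q Y West"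
      using c(2) n(2)[of Y] by (auto split: if_splits)
  qed (use c e disj in auto)
  have "e\<^sub>E \<noteq> f\<^sub>W"
    using functional_edges_distinct e c(1) by blast
  show "cut_defined (cut_tree P e\<^sub>W e\<^sub>E Q) f\<^sub>W f\<^sub>E R"
    unfolding cut_defined_iff
  proof (intro conjI allI)
    fix Y
    \<comment> \<open>If \<open>f\<^sub>E\<close> is not the west mark of \<open>R\<close>, that
      mark passes to the cut of \<open>Q\<close> and \<open>R\<close> and differs from
      \<open>e\<^sub>E\<close>. So \<open>e\<^sub>W\<close> is the east mark of \<open>P\<close>,
      and the east mark is taken from \<open>Q\<close>, where it is
      \<open>f\<^sub>W\<close>.\<close>
    show "f\<^sub>W = root_mark (cut_tree P e\<^sub>W e\<^sub>E Q) Y East \<or> f\<^sub>E = root_mark R Y West"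
      using c n[of Y] by (auto split: if_splits)
    show "functional_E_edge (root_graph (cut_tree P e\<^sub>W e\<^sub>E Q)) f\<^sub>W"
      using c(1) \<open>e\<^sub>E \<noteq> f\<^sub>W\<close> functional_E_edge_graph_cut[OF cut_defined_graph_cut[OF PQ]] by simp
    show "pverts (root_graph (cut_tree P e\<^sub>W e\<^sub>E Q)) \<inter> pverts (root_graph R) = {}"
      using c(1) disj pverts_graph_cut[of "root_graph P" e\<^sub>W e\<^sub>E "root_graph Q"] by auto
  qed (use c cut_defined_construction[OF PQ] in auto)
qed

lemma cut_commute_E:
  assumes PQ: "cut_defined P e\<^sub>W e\<^sub>E Q" and PQR: "cut_defined (cut_tree P e\<^sub>W e\<^sub>E Q) f\<^sub>W f\<^sub>E R"
    and f: "functional_E_edge (root_graph P) f\<^sub>W" "f\<^sub>W \<noteq> e\<^sub>W"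
    and disj: "pverts (root_graph P) \<inter> pverts (root_graph R) = {}"
      "pverts (root_graph Q) \<inter> pverts (root_graph R) = {}"
  shows "cut_defined P f\<^sub>W f\<^sub>E R" "cut_defined (cut_tree P f\<^sub>W f\<^sub>E R) e\<^sub>W e\<^sub>E Q"
proof -
  note c = PQ[unfolded cut_defined_iff] PQR[unfolded cut_defined_iff]
  have v: "fst e\<^sub>W \<in> pverts (root_graph P)" "fst f\<^sub>W \<in> pverts (root_graph P)"
    using cut_edge_verts[OF PQ] functional_edge_verts f c(1)
      construction_invariants[of P] by blast+
  have n: "root_mark Q Y East \<noteq> f\<^sub>W" "root_mark R Y East \<noteq> e\<^sub>W" for Y
    by (rule mark_neq; use c v disj in blast)+
  show PR: "cut_defined P f\<^sub>W f\<^sub>E R"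
    unfolding cut_defined_iff
  proof (intro conjI allI)
    fix Y
    show "f\<^sub>W = root_mark P Y East \<or> f\<^sub>E = root_mark R Y West"
      using c(2) n(1)[of Y] by (auto split: if_splits)
  qed (use c f disj in auto)
  show "cut_defined (cut_tree P f\<^sub>W f\<^sub>E R) e\<^sub>W e\<^sub>E Q"
    unfolding cut_defined_iff
  proof (intro conjI allI)
    fix Y
    \<comment> \<open>If \<open>e\<^sub>W\<close> is the east mark of \<open>P\<close>, then
      \<open>f\<^sub>W\<close> is not, so cutting at \<open>f\<^sub>W\<close> leaves this mark
      unchanged.\<close>
    show "e\<^sub>W = root_mark (cut_tree P f\<^sub>W f\<^sub>E R) Y East \<or> e\<^sub>E = root_mark Q Y West"
      using c(1) f(2) by (auto split: if_splits)
    show "functional_E_edge (root_graph (cut_tree P f\<^sub>W f\<^sub>E R)) e\<^sub>W"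
      using c(1) f(2) functional_E_edge_graph_cut[OF cut_defined_graph_cut[OF PR]] by simp
    show "pverts (root_graph (cut_tree P f\<^sub>W f\<^sub>E R)) \<inter> pverts (root_graph Q) = {}"
      using c(1) disj pverts_graph_cut[of "root_graph P" f\<^sub>W f\<^sub>E "root_graph R"] by auto
  qed (use c cut_defined_construction[OF PR] in auto)
qed

lemma cut_commute_W:
  assumes QP: "cut_defined Q e\<^sub>W e\<^sub>E P" and RQP: "cut_defined R f\<^sub>W f\<^sub>E (cut_tree Q e\<^sub>W e\<^sub>E P)"
    and f: "functional_W_edge (root_graph P) f\<^sub>E" "f\<^sub>E \<noteq> e\<^sub>E"
    and disj: "pverts (root_graph R) \<inter> pverts (root_graph P) = {}"
      "pverts (root_graph R) \<inter> pverts (root_graph Q) = {}"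
  shows "cut_defined R f\<^sub>W f\<^sub>E P" "cut_defined Q e\<^sub>W e\<^sub>E (cut_tree R f\<^sub>W f\<^sub>E P)"
proof -
  note c = QP[unfolded cut_defined_iff] RQP[unfolded cut_defined_iff]
  have v: "fst e\<^sub>E \<in> pverts (root_graph P)" "fst f\<^sub>E \<in> pverts (root_graph P)"
    using cut_edge_verts[OF QP] functional_edge_verts f c(1)
      construction_invariants[of P] by blast+
  have n: "root_mark Q Y West \<noteq> f\<^sub>E" "root_mark R Y West \<noteq> e\<^sub>E" for Y
    by (rule mark_neq; use c v disj in blast)+
  show RP: "cut_defined R f\<^sub>W f\<^sub>E P"
    unfolding cut_defined_iff
  proof (intro conjI allI)
    fix Y
    show "f\<^sub>W = root_mark R Y East \<or> f\<^sub>E = root_mark P Y West"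
      using c(2) n(1)[of Y] by (auto split: if_splits)
  qed (use c f disj in auto)
  show "cut_defined Q e\<^sub>W e\<^sub>E (cut_tree R f\<^sub>W f\<^sub>E P)"
    unfolding cut_defined_iff
  proof (intro conjI allI)
    fix Y
    show "e\<^sub>W = root_mark Q Y East \<or> e\<^sub>E = root_mark (cut_tree R f\<^sub>W f\<^sub>E P) Y West"
      using c(1) f(2) by (auto split: if_splits)
    show "functional_W_edge (root_graph (cut_tree R f\<^sub>W f\<^sub>E P)) e\<^sub>E"
      using c(1) f(2) functional_W_edge_graph_cut[OF cut_defined_graph_cut[OF RP]] by simp
    show "pverts (root_graph Q) \<inter> pverts (root_graph (cut_tree R f\<^sub>W f\<^sub>E P)) = {}"
      using c(1) disj pverts_graph_cut[of "root_graph R" f\<^sub>W f\<^sub>E "root_graph P"] by auto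
  qed (use c cut_defined_construction[OF RP] in auto)
qed

section \<open>Bringing a given inner edge to the last cut\<close>

text \<open>The label and the vertices are part of the induction hypothesis: equality of labels makes
  an enclosing cut remain defined after a subtree is replaced, and the vertices keep the subtrees
  disjoint.\<close>

definition splits_at :: "'a ktree \<Rightarrow> 'a \<times> 'a \<Rightarrow> bool" where
  "splits_at G e \<longleftrightarrow> (\<exists>H\<^sub>W H\<^sub>E e\<^sub>W e\<^sub>E. cut_defined H\<^sub>W e\<^sub>W e\<^sub>E H\<^sub>E \<and> new_edge e\<^sub>W e\<^sub>E = e \<and>
     rho_equivalent G (cut_tree H\<^sub>W e\<^sub>W e\<^sub>E H\<^sub>E) \<and>
     root_label (cut_tree H\<^sub>W e\<^sub>W e\<^sub>E H\<^sub>E) = root_label G \<and>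
     all_verts (cut_tree H\<^sub>W e\<^sub>W e\<^sub>E H\<^sub>E) = all_verts G \<and>
     no_clash (cut_tree H\<^sub>W e\<^sub>W e\<^sub>E H\<^sub>E))"

lemma inner_edge_not_functional:
  assumes "inner_edge D e"
  shows "\<not> functional_E_edge D e" "\<not> functional_W_edge D e"
  using assms
  by (auto simp: inner_edge_def inner_vertex_def functional_E_edge_def E_edge_def
      functional_W_edge_def W_edge_def)

text \<open>Since \<open>e\<close> is inner, \<open>f\<^sub>W\<close> is not the edge introduced by
  the inner cut, so it comes from \<open>P\<close> or from \<open>Q\<close>. In \<open>P\<close> the
  two cuts use different E-edges of \<open>P\<close> and commute by \<open>rho2\<close>; in
  \<open>Q\<close> they are regrouped by \<open>rho1\<close>.\<close>

lemma splits_at_west: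
  assumes "splits_at G\<^sub>W e" "inner_edge (root_graph G\<^sub>W) e"
    and G: "cut_defined G\<^sub>W f\<^sub>W f\<^sub>E R" "no_clash (cut_tree G\<^sub>W f\<^sub>W f\<^sub>E R)"
  shows "splits_at (cut_tree G\<^sub>W f\<^sub>W f\<^sub>E R) e"
proof -
  obtain P Q e\<^sub>W e\<^sub>E where H: "cut_defined P e\<^sub>W e\<^sub>E Q" "new_edge e\<^sub>W e\<^sub>E = e"
      "rho_equivalent G\<^sub>W (cut_tree P e\<^sub>W e\<^sub>E Q)"
      "root_label (cut_tree P e\<^sub>W e\<^sub>E Q) = root_label G\<^sub>W"
      "all_verts (cut_tree P e\<^sub>W e\<^sub>E Q) = all_verts G\<^sub>W" "no_clash (cut_tree P e\<^sub>W e\<^sub>E Q)"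
    using assms(1) unfolding splits_at_def by blast
  have cons: "construction P" "construction Q" "construction R"
    using H(1) G(1) by (simp_all add: cut_defined_def)
  have PQR: "cut_defined (cut_tree P e\<^sub>W e\<^sub>E Q) f\<^sub>W f\<^sub>E R"
    \<comment> \<open>The enclosing cut stays defined because the rearranged subtree has the label
      of \<open>G\<^sub>W\<close>.\<close>
    using cut_defined_cong[OF cut_defined_construction[OF H(1)] cons(3) H(4)[symmetric] HOL.refl G(1)] .
  have eq: "rho_equivalent (cut_tree G\<^sub>W f\<^sub>W f\<^sub>E R) (cut_tree (cut_tree P e\<^sub>W e\<^sub>E Q) f\<^sub>W f\<^sub>E R)"
    using rho_equivalent.cong[OF H(3) rho_equivalent.refl[OF cons(3)] G(1) PQR] .
  have label: "root_label (cut_tree (cut_tree P e\<^sub>W e\<^sub>E Q) f\<^sub>W f\<^sub>E R) = root_label (cut_tree G\<^sub>W f\<^sub>W f\<^sub>E R)"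
    using root_label_cut_tree_cong[OF H(4) HOL.refl] .
  have clash: "no_clash P" "no_clash Q" "no_clash R" "all_verts P \<inter> all_verts Q = {}"
      "all_verts P \<inter> all_verts R = {}" "all_verts Q \<inter> all_verts R = {}"
    and verts: "all_verts G\<^sub>W = all_verts P \<union> all_verts Q"
    using H(5,6) G(2) by (auto simp: no_clash_cut_tree all_verts_cut_tree)
  note disj = clash(4-6)[THEN root_verts_disjoint]
  have "functional_E_edge (root_graph (cut_tree P e\<^sub>W e\<^sub>E Q)) f\<^sub>W"
    using PQR by (simp add: cut_defined_iff)
  moreover have "f\<^sub>W \<noteq> new_edge e\<^sub>W e\<^sub>E"
    using inner_edge_not_functional(1)[OF assms(2)] G(1) H(2) by (auto simp: cut_defined_iff)
  ultimately consider "f\<^sub>W \<noteq> e\<^sub>W" "functional_E_edge (root_graph P) f\<^sub>W"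
    | "functional_E_edge (root_graph Q) f\<^sub>W"
    using functional_E_edge_graph_cut[OF cut_defined_graph_cut[OF H(1)]] by auto
  then show ?thesis
  proof cases
    case 1
    note d = cut_commute_E[OF H(1) PQR 1(2,1) disj(2,3)]
    have "rho_equivalent (cut_tree G\<^sub>W f\<^sub>W f\<^sub>E R) (cut_tree (cut_tree P f\<^sub>W f\<^sub>E R) e\<^sub>W e\<^sub>E Q)"
      using eq rho_equivalent.rho2[OF rho2.intros[OF H(1) PQR d 1(1)[symmetric]]]
      by (rule rho_equivalent.trans)
    moreover have "root_label (cut_tree (cut_tree P f\<^sub>W f\<^sub>E R) e\<^sub>W e\<^sub>E Q) = root_label (cut_tree G\<^sub>W f\<^sub>W f\<^sub>E R)"
      using label root_label_cut_commute_E[OF H(1) d(1) 1(1)[symmetric] disj(3)] by simp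
    moreover have "no_clash (cut_tree (cut_tree P f\<^sub>W f\<^sub>E R) e\<^sub>W e\<^sub>E Q)"
      "all_verts (cut_tree (cut_tree P f\<^sub>W f\<^sub>E R) e\<^sub>W e\<^sub>E Q) = all_verts (cut_tree G\<^sub>W f\<^sub>W f\<^sub>E R)"
      using clash verts by (auto simp: no_clash_cut_tree all_verts_cut_tree)
    ultimately show ?thesis
      unfolding splits_at_def using d(2) H(2) by blast
  next
    case 2
    note d = cut_assoc_right[OF H(1) PQR 2 disj(2,3)]
    have "rho_equivalent (cut_tree G\<^sub>W f\<^sub>W f\<^sub>E R) (cut_tree P e\<^sub>W e\<^sub>E (cut_tree Q f\<^sub>W f\<^sub>E R))"
      using eq rho_equivalent.rho1[OF rho1.intros[OF H(1) PQR d]]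
      by (rule rho_equivalent.trans)
    moreover have "root_label (cut_tree P e\<^sub>W e\<^sub>E (cut_tree Q f\<^sub>W f\<^sub>E R)) = root_label (cut_tree G\<^sub>W f\<^sub>W f\<^sub>E R)"
      using label root_label_cut_assoc[OF H(1) d(1) disj(2)] by simp
    moreover have "no_clash (cut_tree P e\<^sub>W e\<^sub>E (cut_tree Q f\<^sub>W f\<^sub>E R))"
      "all_verts (cut_tree P e\<^sub>W e\<^sub>E (cut_tree Q f\<^sub>W f\<^sub>E R)) = all_verts (cut_tree G\<^sub>W f\<^sub>W f\<^sub>E R)"
      using clash verts by (auto simp: no_clash_cut_tree all_verts_cut_tree)
    ultimately show ?thesis
      unfolding splits_at_def using d(2) H(2) by blast
  qed
qed

text \<open>The mirror image: if \<open>f\<^sub>E\<close> comes from \<open>Q\<close>, both cuts use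
  W-edges of \<open>Q\<close> and commute by \<open>rho3\<close>; if it comes from \<open>P\<close>,
  then \<open>P\<close> is the middle part and \<open>rho1\<close> is read from right to
  left.\<close>

lemma splits_at_east:
  assumes "splits_at G\<^sub>E e" "inner_edge (root_graph G\<^sub>E) e"
    and G: "cut_defined R f\<^sub>W f\<^sub>E G\<^sub>E" "no_clash (cut_tree R f\<^sub>W f\<^sub>E G\<^sub>E)"
  shows "splits_at (cut_tree R f\<^sub>W f\<^sub>E G\<^sub>E) e"
proof -
  obtain P Q e\<^sub>W e\<^sub>E where H: "cut_defined P e\<^sub>W e\<^sub>E Q" "new_edge e\<^sub>W e\<^sub>E = e"
      "rho_equivalent G\<^sub>E (cut_tree P e\<^sub>W e\<^sub>E Q)"
      "root_label (cut_tree P e\<^sub>W e\<^sub>E Q) = root_label G\<^sub>E"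
      "all_verts (cut_tree P e\<^sub>W e\<^sub>E Q) = all_verts G\<^sub>E" "no_clash (cut_tree P e\<^sub>W e\<^sub>E Q)"
    using assms(1) unfolding splits_at_def by blast
  have cons: "construction P" "construction Q" "construction R"
    using H(1) G(1) by (simp_all add: cut_defined_def)
  have RPQ: "cut_defined R f\<^sub>W f\<^sub>E (cut_tree P e\<^sub>W e\<^sub>E Q)"
    using cut_defined_cong[OF cons(3) cut_defined_construction[OF H(1)] HOL.refl H(4)[symmetric] G(1)] .
  have eq: "rho_equivalent (cut_tree R f\<^sub>W f\<^sub>E G\<^sub>E) (cut_tree R f\<^sub>W f\<^sub>E (cut_tree P e\<^sub>W e\<^sub>E Q))"
    using rho_equivalent.cong[OF rho_equivalent.refl[OF cons(3)] H(3) G(1) RPQ] .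
  have label: "root_label (cut_tree R f\<^sub>W f\<^sub>E (cut_tree P e\<^sub>W e\<^sub>E Q)) = root_label (cut_tree R f\<^sub>W f\<^sub>E G\<^sub>E)"
    using root_label_cut_tree_cong[OF HOL.refl H(4)] .
  have clash: "no_clash P" "no_clash Q" "no_clash R" "all_verts P \<inter> all_verts Q = {}"
      "all_verts R \<inter> all_verts P = {}" "all_verts R \<inter> all_verts Q = {}"
    and verts: "all_verts G\<^sub>E = all_verts P \<union> all_verts Q"
    using H(5,6) G(2) by (auto simp: no_clash_cut_tree all_verts_cut_tree)
  note disj = clash(4-6)[THEN root_verts_disjoint]
  have "functional_W_edge (root_graph (cut_tree P e\<^sub>W e\<^sub>E Q)) f\<^sub>E"
    using RPQ by (simp add: cut_defined_iff)
  moreover have "f\<^sub>E \<noteq> new_edge e\<^sub>W e\<^sub>E"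
    using inner_edge_not_functional(2)[OF assms(2)] G(1) H(2) by (auto simp: cut_defined_iff)
  ultimately consider "f\<^sub>E \<noteq> e\<^sub>E" "functional_W_edge (root_graph Q) f\<^sub>E"
    | "functional_W_edge (root_graph P) f\<^sub>E"
    using functional_W_edge_graph_cut[OF cut_defined_graph_cut[OF H(1)]] by auto
  then show ?thesis
  proof cases
    case 1
    note d = cut_commute_W[OF H(1) RPQ 1(2,1) disj(3,2)]
    have "rho_equivalent (cut_tree R f\<^sub>W f\<^sub>E G\<^sub>E) (cut_tree P e\<^sub>W e\<^sub>E (cut_tree R f\<^sub>W f\<^sub>E Q))"
      using eq rho_equivalent.rho3[OF rho3.intros[OF H(1) RPQ d 1(1)[symmetric]]]
      by (rule rho_equivalent.trans)
    moreover have "root_label (cut_tree P e\<^sub>W e\<^sub>E (cut_tree R f\<^sub>W f\<^sub>E Q)) = root_label (cut_tree R f\<^sub>W f\<^sub>E G\<^sub>E)"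
      using label root_label_cut_commute_W[OF H(1) d(1) 1(1)[symmetric]] disj(2) by (simp add: Int_commute)
    moreover have "no_clash (cut_tree P e\<^sub>W e\<^sub>E (cut_tree R f\<^sub>W f\<^sub>E Q))"
      "all_verts (cut_tree P e\<^sub>W e\<^sub>E (cut_tree R f\<^sub>W f\<^sub>E Q)) = all_verts (cut_tree R f\<^sub>W f\<^sub>E G\<^sub>E)"
      using clash verts by (auto simp: no_clash_cut_tree all_verts_cut_tree)
    ultimately show ?thesis
      unfolding splits_at_def using d(2) H(2) by blast
  next
    case 2
    note d = cut_assoc_left[OF H(1) RPQ 2 disj(2,3)]
    have "rho_equivalent (cut_tree R f\<^sub>W f\<^sub>E G\<^sub>E) (cut_tree (cut_tree R f\<^sub>W f\<^sub>E P) e\<^sub>W e\<^sub>E Q)"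
      using eq rho_equivalent.sym[OF rho_equivalent.rho1[OF rho1.intros[OF d H(1) RPQ]]]
      by (rule rho_equivalent.trans)
    moreover have "root_label (cut_tree (cut_tree R f\<^sub>W f\<^sub>E P) e\<^sub>W e\<^sub>E Q) = root_label (cut_tree R f\<^sub>W f\<^sub>E G\<^sub>E)"
      using label root_label_cut_assoc[OF d(1) H(1) disj(3)] by simp
    moreover have "no_clash (cut_tree (cut_tree R f\<^sub>W f\<^sub>E P) e\<^sub>W e\<^sub>E Q)"
      "all_verts (cut_tree (cut_tree R f\<^sub>W f\<^sub>E P) e\<^sub>W e\<^sub>E Q) = all_verts (cut_tree R f\<^sub>W f\<^sub>E G\<^sub>E)"
      using clash verts by (auto simp: no_clash_cut_tree all_verts_cut_tree)
    ultimately show ?thesis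
      unfolding splits_at_def using d(2) H(2) by blast
  qed
qed

text \<open>An old edge has both endpoints in one half. They are inner in one of the halves, and by
  disjointness it is this one.\<close>

lemma inner_edge_graph_cut:
  assumes "graph_cut_defined D\<^sub>W e\<^sub>W e\<^sub>E D\<^sub>E" "inner_edge (graph_cut D\<^sub>W e\<^sub>W e\<^sub>E D\<^sub>E) e"
  shows "e = new_edge e\<^sub>W e\<^sub>E \<or> inner_edge D\<^sub>W e \<or> inner_edge D\<^sub>E e"
proof -
  have o: "oriented_graph D\<^sub>W" "oriented_graph D\<^sub>E" "pverts D\<^sub>W \<inter> pverts D\<^sub>E = {}"
    using assms(1) by (simp_all add: graph_cut_defined_def)
  have v: "fst e \<in> pverts D \<and> snd e \<in> pverts D" if "e \<in> parcs D" "oriented_graph D" for D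
    using that by (cases e) (auto simp: oriented_graph_iff)
  have "inner_vertex D v \<Longrightarrow> v \<in> pverts D" for D and v :: 'a
    by (simp add: inner_vertex_def)
  moreover have "e = new_edge e\<^sub>W e\<^sub>E \<or> e \<in> parcs D\<^sub>W \<or> e \<in> parcs D\<^sub>E"
    using assms(2) by (auto simp: inner_edge_def graph_cut_def)
  ultimately show ?thesis
    using assms(2) o v unfolding inner_edge_def inner_vertex_graph_cut[OF assms(1)] by blast
qed

lemma construction_splits_at:
  assumes "construction G" "no_clash G" "inner_edge (root_graph G) e"
  shows "splits_at G e"
  using assms
proof (induction arbitrary: e)
  case (basic B)
  then show ?case
    using basic_K_graph_edges(4) by fastforce
next
  case (cut G\<^sub>W G\<^sub>E f\<^sub>W f\<^sub>E)
  have def: "cut_defined G\<^sub>W f\<^sub>W f\<^sub>E G\<^sub>E"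
    using cut.hyps by (simp add: cut_defined_def)
  have clash: "no_clash G\<^sub>W" "no_clash G\<^sub>E"
    using cut.prems(1) by (simp_all add: no_clash_cut_tree)
  consider "e = new_edge f\<^sub>W f\<^sub>E" | "inner_edge (root_graph G\<^sub>W) e" | "inner_edge (root_graph G\<^sub>E) e"
    using inner_edge_graph_cut[OF cut_defined_graph_cut[OF def]] cut.prems(2)
    unfolding root_graph_cut_tree by blast
  then show ?case
  proof cases
    case 1
    \<comment> \<open>The tree itself is the witness, with its own two subtrees and its last
      cut.\<close>
    then show ?thesis
      unfolding splits_at_def
      using def cut.prems(1) rho_equivalent.refl[OF cut_defined_construction[OF def]] by blast
  next
    case 2
    then show ?thesis
      using splits_at_west cut.IH(1) clash(1) def cut.prems(1) by blast
  next
    case 3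
    then show ?thesis
      using splits_at_east cut.IH(2) clash(2) def cut.prems(1) by blast
  qed
qed

theorem proposition2p4:
  fixes G :: "'a ktree" and e :: "'a \<times> 'a"
  assumes "construction G"
    and "no_clash G"
    and "inner_edge (root_graph G) e"
  shows "\<exists>H\<^sub>W H\<^sub>E e\<^sub>W e\<^sub>E. construction H\<^sub>W \<and> construction H\<^sub>E \<and> cut_defined H\<^sub>W e\<^sub>W e\<^sub>E H\<^sub>E \<and>
           new_edge e\<^sub>W e\<^sub>E = e \<and> rho_equivalent G (cut_tree H\<^sub>W e\<^sub>W e\<^sub>E H\<^sub>E)"
  using construction_splits_at[OF assms] unfolding splits_at_def cut_defined_def by blast

end
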